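(* Let $X$ be an observable with values $x$, let $\theta=(\theta_1,\theta_2)$ with $\theta_1\in\mathbb{R}^d$, $\theta_2\in\mathbb{R}_+$ (positive), and let $\pi$ be a prior for $\theta$. Suppose that the posterior density for $\theta$ is, for all $x$, location-scale invariant of the form $$\theta|x\sim\frac{1}{\sigma(x)\,\theta_2^d}\,f\Big(\frac{\theta_1-\mu(x)}{\theta_2},\frac{\theta_2}{\sigma(x)}\Big),$$ where $\mu(x)\in\mathbb{R}^d$, $\sigma(x)>0$, and $f$ does not depend on $x$, and that the first-stage loss for estimating $\theta_1$ is location-scale invariant, i.e. of the form $L(\theta,\hat\theta_1)=\rho\big(\frac{\hat\theta_1-\theta_1}{\theta_2}\big)$. Then: (a) the Bayes estimator $\hat\theta_{1,\pi}(X)$, whenever it exists, is of the form $\hat\theta_{1,\pi}(x)=\mu(x)+k\,\sigma(x)$, $k$ being a constant (not depending on $x$); (b) the posterior distribution of the loss $L(\theta,\hat\theta_{1,\pi}(x))$ is free of $x$ (does not depend on $x$); (c) the Bayes estimator $\hat L_\pi(x)$ of the loss $L(\theta,\hat\theta_{1,\pi}(x))$ with respect to second-stage loss $W(L,\hat L)$ is, whenever it exists, free of $x$.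
   Context: Here $\rho$ is a nonnegative function on $\mathbb{R}^d$ and the constant $k$ is a vector in $\mathbb{R}^d$. All posterior quantities are with respect to the (possibly improper) prior $\pi$. A Bayes estimator $\hat\theta_{1,\pi}(x)$ of $\theta_1$ under first-stage loss $L(\theta,\hat\theta_1)$ minimizes in $\hat\theta_1\in\mathbb{R}^d$ the expected posterior loss $\mathbb{E}(L(\theta,\hat\theta_1)|x)$. A second-stage loss is a function $W(L,\hat L)\in[0,\infty)$ used for estimating the loss value $L=L(\theta,\hat\theta_{1,\pi}(x))$ by $\hat L$. A Bayes estimator $\hat L_\pi(x)$ of $L$ minimizes in $\hat L$ the expected posterior loss $\mathbb{E}(W(L,\hat L)|x)$, where the expectation is with respect to the posterior distribution of $\theta$ given $x$. *)

theory Defs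
  imports "HOL-Probability.Probability"
begin

text \<open>Parameters are pairs of a location vector and a positive scale.\<close>

definition loc_scale_space :: "((real ^ 'd) \<times> real) set" where
  "loc_scale_space = UNIV \<times> {0<..}"

text \<open>
  The prior need not be finite, only \<open>\<sigma>\<close>-finite, so \<open>prior \<bind> P\<close> (the marginal law of the
  observable) may be an infinite measure; a posterior is a disintegration of the joint measure with
  respect to it, which covers both proper and improper priors and requires no dominating measure
  for the sampling distributions.
\<close>

definition is_posterior ::
  "'x measure \<Rightarrow> 't measure \<Rightarrow> ('t \<Rightarrow> 'x measure) \<Rightarrow> ('x \<Rightarrow> 't measure) \<Rightarrow> bool" where
  "is_posterior X prior P post \<longleftrightarrow>
     sigma_finite_measure prior \<and>
     P \<in> prior \<rightarrow>\<^sub>M prob_algebra X \<and>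
     post \<in> X \<rightarrow>\<^sub>M prob_algebra prior \<and>
     sigma_finite_measure (prior \<bind> P) \<and>
     (\<forall>C\<in>sets prior. \<forall>B\<in>sets X.
        (\<integral>\<^sup>+\<theta>\<in>C. emeasure (P \<theta>) B \<partial>prior) = (\<integral>\<^sup>+x\<in>B. emeasure (post x) C \<partial>(prior \<bind> P)))"

definition expected_loss :: "'t measure \<Rightarrow> ('t \<Rightarrow> 'a \<Rightarrow> real) \<Rightarrow> 'a \<Rightarrow> ennreal" where
  "expected_loss M l a = (\<integral>\<^sup>+\<theta>. ennreal (l \<theta> a) \<partial>M)"

text \<open>
  All minimizers over the decision space \<open>D\<close>: a Bayes estimate exists iff this set is nonempty, and
  is unique iff it is a singleton.
\<close>

definition bayes_estimates :: "'t measure \<Rightarrow> ('t \<Rightarrow> 'a \<Rightarrow> real) \<Rightarrow> 'a set \<Rightarrow> 'a set" where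
  "bayes_estimates M l D = {a. is_arg_min (expected_loss M l) (\<lambda>a. a \<in> D) a}"

end

theory Submission
  imports Defs
begin

text \<open>
  The theorem is an instance of equivariance under the affine group.  For \<open>\<sigma> > 0\<close> the map
  \<open>T (w, v) = (\<mu>, 0) + \<sigma> *\<^sub>R (w, v)\<close> dilates location and scale by the same factor, so it is a single
  homothety followed by a translation of the whole parameter space, with Jacobian \<open>\<sigma> ^ (d + 1)\<close>.
  This Jacobian cancels the dependence of the normalising factor on \<open>\<sigma>\<close>, and the posterior at \<open>x\<close> turns
  out to be the image under \<open>T\<close> (with \<open>\<mu> = \<mu> x\<close>, \<open>\<sigma> = \<sigma> x\<close>) of one reference law \<open>Q\<close> with
  density \<open>f (w / v) v / v ^ d\<close> (lemma \<open>location_scale_density_eq_distr\<close>).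

  An invariant loss does not change when the parameter is moved by \<open>T\<close> and the decision \<open>k\<close> is
  moved to \<open>\<mu> + \<sigma> *\<^sub>R k\<close>.  Hence the decision problem at \<open>x\<close> is a relabelled copy of
  the one under \<open>Q\<close>: its minimizers are the images of the minimizers under \<open>Q\<close> (lemma
  \<open>bayes_estimates_distr\<close>), and, at corresponding decisions, the loss has the same law as under
  \<open>Q\<close>.  The second-stage problem depends on the parameter only through that loss, and its decisions
  are not moved at all, so for every \<open>x\<close> it is the second-stage problem under \<open>Q\<close>, provided
  that the same \<open>k\<close> is used for every \<open>x\<close>.  A unique Bayes estimator does this by itself, because
  its \<open>k\<close> is the unique minimizer under \<open>Q\<close>.
\<close>

section \<open>Homotheties and Lebesgue measure\<close>

lemma nn_integral_lborel_affine:
  fixes g :: "'a::euclidean_space \<Rightarrow> ennreal"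
  assumes [measurable]: "g \<in> borel_measurable borel" and c: "c > 0"
  shows "(\<integral>\<^sup>+x. g x \<partial>lborel) = (\<integral>\<^sup>+y. ennreal (c ^ DIM('a)) * g (t + c *\<^sub>R y) \<partial>lborel)"
proof -
  have "(\<integral>\<^sup>+x. g x \<partial>lborel)
      = (\<integral>\<^sup>+x. g x \<partial>density (distr lborel borel (\<lambda>y. t + c *\<^sub>R y)) (\<lambda>_. ennreal (\<bar>c\<bar> ^ DIM('a))))"
    using lborel_affine[of c t] c by simp
  also have "\<dots> = (\<integral>\<^sup>+y. ennreal (c ^ DIM('a)) * g (t + c *\<^sub>R y) \<partial>lborel)"
    using c by (subst nn_integral_density, simp, simp, subst nn_integral_distr, simp_all)
  finally show ?thesis .
qed

text \<open>
  Change of variables with the Jacobian on the side of the source, where it can cancel against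
  factors of the pulled-back density.  The set
  \<open>S\<close> has to be invariant for the map to act on the restricted space.
\<close>

lemma density_affine_eq_distr:
  fixes S :: "'a::euclidean_space set"
  assumes S[measurable]: "S \<in> sets borel" and c: "c > 0"
    and S_affine: "\<And>y. t + c *\<^sub>R y \<in> S \<longleftrightarrow> y \<in> S"
    and g: "g \<in> borel_measurable (restrict_space borel S)"
  shows "density (restrict_space lborel S) g =
    distr (density (restrict_space lborel S) (\<lambda>y. ennreal (c ^ DIM('a)) * g (t + c *\<^sub>R y)))
      (restrict_space borel S) (\<lambda>y. t + c *\<^sub>R y)" (is "_ = distr (density _ ?h) _ ?T")
proof (rule measure_eqI)
  have T: "?T \<in> restrict_space borel S \<rightarrow>\<^sub>M restrict_space borel S"
    by (rule measurable_restrict_space2)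
       (auto simp: S_affine space_restrict_space intro!: measurable_restrict_space1)
  have T': "?T \<in> density (restrict_space lborel S) ?h \<rightarrow>\<^sub>M restrict_space borel S"
    using T by (simp cong: measurable_cong_sets sets_restrict_space_cong)
  have h: "?h \<in> borel_measurable (restrict_space lborel S)"
    using measurable_compose[OF T g] by (simp cong: measurable_cong_sets sets_restrict_space_cong)
  have g': "g \<in> borel_measurable (restrict_space lborel S)"
    using g by (simp cong: measurable_cong_sets sets_restrict_space_cong)
  have gS[measurable]: "(\<lambda>x. g x * indicator S x) \<in> borel_measurable borel"
    using g by (subst (asm) borel_measurable_restrict_space_iff_ennreal) auto
  show "sets (density (restrict_space lborel S) g)
      = sets (distr (density (restrict_space lborel S) ?h) (restrict_space borel S) ?T)"
    by (simp cong: sets_restrict_space_cong)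
  fix B assume "B \<in> sets (density (restrict_space lborel S) g)"
  then have B_restr: "B \<in> sets (restrict_space lborel S)" by simp
  then have B[measurable]: "B \<in> sets borel" and "B \<subseteq> S"
    by (auto simp: sets_restrict_space_iff)
  have BT: "?T -` B \<inter> S \<in> sets (restrict_space lborel S)"
    using measurable_sets[OF T, of B] B_restr
    by (simp add: space_restrict_space cong: sets_restrict_space_cong)
  have "emeasure (density (restrict_space lborel S) g) B
      = (\<integral>\<^sup>+x. (g x * indicator S x) * indicator B x \<partial>lborel)"
    using B_restr g' by (simp add: emeasure_density nn_integral_restrict_space ac_simps)
  also have "\<dots> = (\<integral>\<^sup>+y. ennreal (c ^ DIM('a)) *
      ((g (?T y) * indicator S (?T y)) * indicator B (?T y)) \<partial>lborel)"
    by (rule nn_integral_lborel_affine) (use c in auto)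
  also have "\<dots> = (\<integral>\<^sup>+y. (?h y * indicator (?T -` B \<inter> S) y) * indicator S y \<partial>lborel)"
    by (intro nn_integral_cong) (auto simp: indicator_def S_affine)
  also have "\<dots> = emeasure (density (restrict_space lborel S) ?h) (?T -` B \<inter> S)"
    using BT h by (simp add: emeasure_density nn_integral_restrict_space)
  also have "\<dots> = emeasure (distr (density (restrict_space lborel S) ?h)
      (restrict_space borel S) ?T) B"
    using B_restr by (subst emeasure_distr[OF T'])
      (simp_all add: space_restrict_space cong: sets_restrict_space_cong)
  finally show "emeasure (density (restrict_space lborel S) g) B
      = emeasure (distr (density (restrict_space lborel S) ?h) (restrict_space borel S) ?T) B" .
qed

section \<open>Location-scale posteriors as images of a reference law\<close>

lemma loc_scale_space_borel [measurable]: "loc_scale_space \<in> sets borel"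
  unfolding loc_scale_space_def by (intro borel_open open_Times) auto

lemma mem_loc_scale_space [simp]: "(w, v) \<in> loc_scale_space \<longleftrightarrow> v > 0"
  by (simp add: loc_scale_space_def)

text \<open>
  The posterior density at \<open>x\<close> is \<open>loc_scale_density f (\<mu> x) (\<sigma> x)\<close>; location \<open>0\<close> and scale \<open>1\<close>
  give the density of the reference law.
\<close>

definition loc_scale_density ::
  "(real ^ 'd \<Rightarrow> real \<Rightarrow> real) \<Rightarrow> real ^ 'd \<Rightarrow> real \<Rightarrow> (real ^ 'd) \<times> real \<Rightarrow> ennreal" where
  "loc_scale_density f m c =
     (\<lambda>(\<theta>\<^sub>1, \<theta>\<^sub>2). ennreal (1 / (c * \<theta>\<^sub>2 ^ CARD('d)) * f ((\<theta>\<^sub>1 - m) /\<^sub>R \<theta>\<^sub>2) (\<theta>\<^sub>2 / c)))"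

lemma loc_scale_density_measurable:
  fixes f :: "real ^ 'd \<Rightarrow> real \<Rightarrow> real"
  assumes f: "case_prod f \<in> borel_measurable (restrict_space borel loc_scale_space)" and "c > 0"
  shows "loc_scale_density f m c \<in> borel_measurable (restrict_space borel loc_scale_space)"
proof -
  let ?R = "restrict_space borel loc_scale_space :: ((real ^ 'd) \<times> real) measure"
  have "(\<lambda>\<theta>. ((fst \<theta> - m) /\<^sub>R snd \<theta>, snd \<theta> / c)) \<in> ?R \<rightarrow>\<^sub>M ?R"
    using \<open>c > 0\<close>
    by (intro measurable_restrict_space2 measurable_restrict_space1)
       (auto simp: space_restrict_space loc_scale_space_def borel_prod[symmetric])
  from measurable_compose[OF this f]
  have [measurable]: "(\<lambda>\<theta>. f ((fst \<theta> - m) /\<^sub>R snd \<theta>) (snd \<theta> / c)) \<in> borel_measurable ?R"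
    by simp
  have [measurable]: "snd \<in> borel_measurable ?R"
    by (intro measurable_restrict_space1) (simp add: borel_prod[symmetric])
  show ?thesis
    unfolding loc_scale_density_def split_beta by measurable
qed

text \<open>
  The exponent \<open>d + 1\<close> of the Jacobian is the dimension of the joint parameter space; \<open>d\<close> of these
  factors are absorbed by \<open>\<theta>\<^sub>2 ^ d\<close> and the last one by the factor \<open>c\<close> in front of it.
\<close>

lemma location_scale_density_eq_distr:
  fixes f :: "real ^ 'd \<Rightarrow> real \<Rightarrow> real"
  assumes f: "case_prod f \<in> borel_measurable (restrict_space borel loc_scale_space)"
    and c: "c > 0"
  shows "density (restrict_space lborel loc_scale_space) (loc_scale_density f m c) =
    distr (density (restrict_space lborel loc_scale_space) (loc_scale_density f 0 1))
      (restrict_space borel loc_scale_space) (\<lambda>y. (m, 0) + c *\<^sub>R y)"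
proof -
  have meas: "loc_scale_density f a b \<in> borel_measurable (restrict_space lborel loc_scale_space)"
    if "b > 0" for a b
    using loc_scale_density_measurable[OF f that]
    by (simp cong: measurable_cong_sets sets_restrict_space_cong)
  have T: "(\<lambda>y. (m, 0) + c *\<^sub>R y)
      \<in> restrict_space lborel loc_scale_space \<rightarrow>\<^sub>M restrict_space lborel loc_scale_space"
    using c by (intro measurable_restrict_space2 measurable_restrict_space1)
      (auto simp: space_restrict_space loc_scale_space_def)
  have "ennreal (c ^ DIM((real ^ 'd) \<times> real)) * loc_scale_density f m c ((m, 0) + c *\<^sub>R (w, v))
      = loc_scale_density f 0 1 (w, v)" if "v > 0" for w v
    using c that
    by (simp add: loc_scale_density_def ennreal_mult'[symmetric] power_mult_distrib field_simps)
  then have density_eq: "density (restrict_space lborel loc_scale_space)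
        (\<lambda>y. ennreal (c ^ DIM((real ^ 'd) \<times> real)) * loc_scale_density f m c ((m, 0) + c *\<^sub>R y))
      = density (restrict_space lborel loc_scale_space) (loc_scale_density f 0 1)"
    using meas[OF c] meas[OF zero_less_one] c
    by (intro density_cong borel_measurable_times_ennreal measurable_const
          measurable_compose[OF T] AE_I2)
       (auto simp: space_restrict_space)
  have "(m, 0) + c *\<^sub>R y \<in> loc_scale_space \<longleftrightarrow> y \<in> loc_scale_space" for y
    using c by (cases y) (simp add: zero_less_mult_iff)
  then show ?thesis
    unfolding density_eq[symmetric]
    by (intro density_affine_eq_distr loc_scale_space_borel c loc_scale_density_measurable f)
qed

section \<open>Equivariance of Bayes estimates\<close>

text \<open>
  Moving the parameter by \<open>T\<close> and the decision by \<open>h\<close> preserves the expected loss, and minimality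
  compares decisions through their expected losses alone.  The first stage uses \<open>h k = \<mu> + \<sigma> *\<^sub>R k\<close>, the
  second stage the identity.
\<close>

lemma bayes_estimates_distr:
  assumes T: "T \<in> M \<rightarrow>\<^sub>M N"
    and meas: "\<And>a. a \<in> D \<Longrightarrow> (\<lambda>\<theta>. l \<theta> (h a)) \<in> borel_measurable N"
    and inv: "\<And>\<omega> a. \<omega> \<in> space M \<Longrightarrow> a \<in> D \<Longrightarrow> l (T \<omega>) (h a) = l' \<omega> a"
  shows "bayes_estimates (distr M N T) l (h ` D) = h ` bayes_estimates M l' D"
proof -
  have "expected_loss (distr M N T) l (h a) = expected_loss M l' a" if "a \<in> D" for a
    unfolding expected_loss_def using meas[OF that] inv that
    by (subst nn_integral_distr[OF T]) (auto intro!: nn_integral_cong)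
  then show ?thesis
    unfolding bayes_estimates_def is_arg_min_def by force
qed

section \<open>Estimation of a location and of the incurred loss\<close>

theorem theorem3:
  fixes X :: "'x measure"
    and prior :: "((real ^ 'd) \<times> real) measure"
    and P :: "(real ^ 'd) \<times> real \<Rightarrow> 'x measure"
    and post :: "'x \<Rightarrow> ((real ^ 'd) \<times> real) measure"
    and \<mu> :: "'x \<Rightarrow> real ^ 'd" and \<sigma> :: "'x \<Rightarrow> real"
    and f :: "real ^ 'd \<Rightarrow> real \<Rightarrow> real"
    and \<rho> :: "real ^ 'd \<Rightarrow> real"
    and L :: "(real ^ 'd) \<times> real \<Rightarrow> real ^ 'd \<Rightarrow> real"
    and W :: "real \<Rightarrow> real \<Rightarrow> real" and A :: "real set"
  assumes "sets prior = sets (restrict_space borel loc_scale_space)"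
    and "is_posterior X prior P post"
    and "\<And>x. x \<in> space X \<Longrightarrow> \<sigma> x > 0"
    and "case_prod f \<in> borel_measurable (restrict_space borel loc_scale_space)"
    and "\<And>u v. v > 0 \<Longrightarrow> f u v \<ge> 0"
    and "\<And>x. x \<in> space X \<Longrightarrow>
           post x = density (restrict_space lborel loc_scale_space)
             (\<lambda>(\<theta>\<^sub>1, \<theta>\<^sub>2). ennreal (1 / (\<sigma> x * \<theta>\<^sub>2 ^ CARD('d)) * f ((\<theta>\<^sub>1 - \<mu> x) /\<^sub>R \<theta>\<^sub>2) (\<theta>\<^sub>2 / \<sigma> x)))"
    and "\<rho> \<in> borel_measurable borel" and "\<And>z. \<rho> z \<ge> 0"
    and "\<And>\<theta>\<^sub>1 \<theta>\<^sub>2 t. \<theta>\<^sub>2 > 0 \<Longrightarrow> L (\<theta>\<^sub>1, \<theta>\<^sub>2) t = \<rho> ((t - \<theta>\<^sub>1) /\<^sub>R \<theta>\<^sub>2)"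
    and "\<And>a. a \<in> A \<Longrightarrow> (\<lambda>l. W l a) \<in> borel_measurable (restrict_space borel {0..})"
    and "\<And>l a. l \<ge> 0 \<Longrightarrow> a \<in> A \<Longrightarrow> W l a \<ge> 0"
  shows
    "(\<comment> \<open>the minimizers are \<open>\<mu> x + k \<sigma> x\<close> with \<open>k\<close> ranging over a set that is free of \<open>x\<close>\<close>
      \<exists>K. \<forall>x\<in>space X. bayes_estimates (post x) L UNIV = (\<lambda>k. \<mu> x + \<sigma> x *\<^sub>R k) ` K) \<and>
     (\<comment> \<open>unique Bayes estimator\<close>
      \<forall>t. (\<forall>x\<in>space X. bayes_estimates (post x) L UNIV = {t x}) \<longrightarrow>
        (\<exists>k. \<forall>x\<in>space X. t x = \<mu> x + \<sigma> x *\<^sub>R k) \<and>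
        (\<lambda>x. distr (post x) borel (\<lambda>\<theta>. L \<theta> (t x))) constant_on space X \<and>
        (\<lambda>x. bayes_estimates (post x) (\<lambda>\<theta>. W (L \<theta> (t x))) A) constant_on space X \<and>
        (\<forall>s. (\<forall>x\<in>space X. bayes_estimates (post x) (\<lambda>\<theta>. W (L \<theta> (t x))) A = {s x}) \<longrightarrow>
           s constant_on space X)) \<and>
     (\<comment> \<open>possibly non-unique Bayes estimator, chosen with the same \<open>k\<close> for every \<open>x\<close>\<close>
      \<forall>t. (\<forall>x\<in>space X. t x \<in> bayes_estimates (post x) L UNIV) \<and>
        (\<exists>k. \<forall>x\<in>space X. t x = \<mu> x + \<sigma> x *\<^sub>R k) \<longrightarrow>
        (\<lambda>x. distr (post x) borel (\<lambda>\<theta>. L \<theta> (t x))) constant_on space X \<and>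
        (\<lambda>x. bayes_estimates (post x) (\<lambda>\<theta>. W (L \<theta> (t x))) A) constant_on space X \<and>
        (\<forall>s. (\<forall>x\<in>space X. bayes_estimates (post x) (\<lambda>\<theta>. W (L \<theta> (t x))) A = {s x}) \<longrightarrow>
           s constant_on space X))"
proof -
  let ?R = "restrict_space borel loc_scale_space :: ((real ^ 'd) \<times> real) measure"
  define Q where "Q = density (restrict_space lborel loc_scale_space) (loc_scale_density f 0 1)"
  define T where "T x = (\<lambda>y :: (real ^ 'd) \<times> real. (\<mu> x, 0) + \<sigma> x *\<^sub>R y)" for x
  have sets_Q: "sets Q = sets ?R"
    by (simp add: Q_def cong: sets_restrict_space_cong)
  have space_Q: "space Q = loc_scale_space"
    by (simp add: Q_def space_restrict_space)
  have post: "post x = distr Q ?R (T x)" if "x \<in> space X" for x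
    using location_scale_density_eq_distr[OF assms(4) assms(3)[OF that], of "\<mu> x"] assms(6)[OF that]
    by (simp add: Q_def T_def loc_scale_density_def)
  have T: "T x \<in> Q \<rightarrow>\<^sub>M ?R" if "x \<in> space X" for x
    unfolding T_def measurable_cong_sets[OF sets_Q refl] using assms(3)[OF that]
    by (intro measurable_restrict_space2 measurable_restrict_space1)
       (auto simp: space_restrict_space loc_scale_space_def)
  have L_meas: "(\<lambda>\<theta>. L \<theta> t) \<in> borel_measurable ?R" for t
  proof -
    have "(\<lambda>\<theta>. \<rho> ((t - fst \<theta>) /\<^sub>R snd \<theta>)) \<in> borel_measurable ?R"
      using assms(7) by (intro measurable_restrict_space1) (simp add: borel_prod[symmetric])
    then show ?thesis
      by (rule measurable_cong[THEN iffD1, rotated])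
         (auto simp: space_restrict_space loc_scale_space_def assms(9))
  qed
  have L_inv: "L (T x y) (\<mu> x + \<sigma> x *\<^sub>R k) = L y k" if x: "x \<in> space X" and y_Q: "y \<in> space Q" for x y k
  proof -
    obtain w v where y: "y = (w, v)" and v: "v > 0"
      using y_Q by (cases y) (simp add: space_Q)
    have "(\<mu> x + \<sigma> x *\<^sub>R k - (\<mu> x + \<sigma> x *\<^sub>R w)) /\<^sub>R (\<sigma> x * v) = (k - w) /\<^sub>R v"
      using assms(3)[OF x] by (simp add: scaleR_diff_right[symmetric])
    then show ?thesis
      using assms(3)[OF x] v by (simp add: T_def y assms(9))
  qed

  define K where "K = bayes_estimates Q L UNIV"
  have K: "bayes_estimates (post x) L UNIV = (\<lambda>k. \<mu> x + \<sigma> x *\<^sub>R k) ` K" if x: "x \<in> space X" for x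
  proof -
    have "t = \<mu> x + \<sigma> x *\<^sub>R ((t - \<mu> x) /\<^sub>R \<sigma> x)" for t
      using assms(3)[OF x] by simp
    then have surj: "range (\<lambda>k. \<mu> x + \<sigma> x *\<^sub>R k) = UNIV"
      by (metis surj_def)
    have "bayes_estimates (distr Q ?R (T x)) L (range (\<lambda>k. \<mu> x + \<sigma> x *\<^sub>R k))
        = (\<lambda>k. \<mu> x + \<sigma> x *\<^sub>R k) ` K"
      unfolding K_def using L_inv[OF x] L_meas by (intro bayes_estimates_distr T x) auto
    then show ?thesis
      by (simp add: surj post[OF x])
  qed

  have loss_law: "distr (post x) borel (\<lambda>\<theta>. L \<theta> (\<mu> x + \<sigma> x *\<^sub>R k)) = distr Q borel (\<lambda>\<theta>. L \<theta> k)"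
    if x: "x \<in> space X" for x k
    unfolding post[OF x] using L_inv[OF x]
    by (subst distr_distr[OF L_meas T[OF x]]) (auto intro!: distr_cong)

  have second_stage: "bayes_estimates (post x) (\<lambda>\<theta>. W (L \<theta> (\<mu> x + \<sigma> x *\<^sub>R k))) A
      = bayes_estimates Q (\<lambda>\<theta>. W (L \<theta> k)) A" if x: "x \<in> space X" for x k
  proof -
    \<comment> \<open>\<open>W\<close> is measurable in the loss on the half-line only, so the loss has to map into it.\<close>
    have "(\<lambda>\<theta>. L \<theta> t) \<in> ?R \<rightarrow>\<^sub>M restrict_space borel {0..}" for t
      using L_meas assms(8)
      by (intro measurable_restrict_space2) (auto simp: space_restrict_space loc_scale_space_def assms(9))
    from measurable_compose[OF this assms(10)]
    have "bayes_estimates (distr Q ?R (T x)) (\<lambda>\<theta>. W (L \<theta> (\<mu> x + \<sigma> x *\<^sub>R k))) ((\<lambda>a. a) ` A)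
        = (\<lambda>a. a) ` bayes_estimates Q (\<lambda>\<theta>. W (L \<theta> k)) A"
      using L_inv[OF x] by (intro bayes_estimates_distr T x) auto
    then show ?thesis
      by (simp add: post[OF x])
  qed

  let ?loss_free = "\<lambda>t. (\<lambda>x. distr (post x) borel (\<lambda>\<theta>. L \<theta> (t x))) constant_on space X \<and>
      (\<lambda>x. bayes_estimates (post x) (\<lambda>\<theta>. W (L \<theta> (t x))) A) constant_on space X \<and>
      (\<forall>s. (\<forall>x\<in>space X. bayes_estimates (post x) (\<lambda>\<theta>. W (L \<theta> (t x))) A = {s x}) \<longrightarrow>
         s constant_on space X)"
  \<comment> \<open>Both kinds of estimator are covered by an estimator \<open>t\<close> that uses one \<open>k\<close> for all \<open>x\<close>.\<close>
  have loss_estimation: "?loss_free t" if t: "\<forall>x\<in>space X. t x = \<mu> x + \<sigma> x *\<^sub>R k" for t k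
  proof -
    have law: "distr (post x) borel (\<lambda>\<theta>. L \<theta> (t x)) = distr Q borel (\<lambda>\<theta>. L \<theta> k)"
      and bayes: "bayes_estimates (post x) (\<lambda>\<theta>. W (L \<theta> (t x))) A
        = bayes_estimates Q (\<lambda>\<theta>. W (L \<theta> k)) A" if "x \<in> space X" for x
      using loss_law[OF that, of k] second_stage[OF that, of k] t that by simp_all
    have "s x = the_elem (bayes_estimates Q (\<lambda>\<theta>. W (L \<theta> k)) A)"
      if "\<forall>x\<in>space X. bayes_estimates (post x) (\<lambda>\<theta>. W (L \<theta> (t x))) A = {s x}" "x \<in> space X" for s x
      using that bayes[of x] by (metis the_elem_eq)
    then show ?thesis
      unfolding constant_on_def using law bayes by blast
  qed

  have unique: "\<exists>k. \<forall>x\<in>space X. t x = \<mu> x + \<sigma> x *\<^sub>R k"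
    if t: "\<forall>x\<in>space X. bayes_estimates (post x) L UNIV = {t x}" for t
  proof (cases "space X = {}")
    case False
    then obtain x\<^sub>0 where "x\<^sub>0 \<in> space X" by blast
    then obtain k where "k \<in> K"
      using t K by blast
    have "t x = \<mu> x + \<sigma> x *\<^sub>R k" if "x \<in> space X" for x
    proof -
      have "\<mu> x + \<sigma> x *\<^sub>R k \<in> {t x}"
        using t K[OF that] that \<open>k \<in> K\<close> by (metis imageI)
      then show ?thesis by simp
    qed
    then show ?thesis by blast
  qed simp

  show ?thesis
  proof (intro conjI, goal_cases)
    case 1
    show ?case using K by blast
  next
    case 2
    show ?case
    proof (intro allI impI)
      fix t assume "\<forall>x\<in>space X. bayes_estimates (post x) L UNIV = {t x}"
      from unique[OF this] obtain k where k: "\<forall>x\<in>space X. t x = \<mu> x + \<sigma> x *\<^sub>R k" ..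
      show "(\<exists>k. \<forall>x\<in>space X. t x = \<mu> x + \<sigma> x *\<^sub>R k) \<and> ?loss_free t"
        using k loss_estimation[OF k] by (intro conjI[OF exI])
    qed
  next
    case 3
    show ?case
    proof (intro allI impI, elim conjE exE)
      fix t k assume k: "\<forall>x\<in>space X. t x = \<mu> x + \<sigma> x *\<^sub>R k"
      show "?loss_free t"
        by (rule loss_estimation[OF k])
    qed
  qed
qed

end
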